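(* For any two sets $A,B\subseteq\{0,1\}^+$ satisfying $\mathcal F^{\preccurlyeq_{\mathrm{nu}}}_{(A,\mathbf{FPT}_{\mathrm{nu}})}=\mathcal F^{\preccurlyeq_{\mathrm{nu}}}_{(B,\mathbf{FPT}_{\mathrm{nu}})}$ we have $\mathcal F^{\preccurlyeq_{\mathrm{nu}}}_{(A,\mathbf{FPT}_{\mathrm{nu}})}\subseteq\mathcal F^{\preccurlyeq_{\mathrm{nu}}}_{(A\triangle B,\mathbf{FPT}_{\mathrm{nu}})}$; i.e., if for every parameterization $\eta$ we have $(A,\eta)\in\mathbf{FPT}_{\mathrm{nu}}\iff(B,\eta)\in\mathbf{FPT}_{\mathrm{nu}}$, then every $\eta$ with $(A,\eta)\in\mathbf{FPT}_{\mathrm{nu}}$ satisfies $(A\triangle B,\eta)\in\mathbf{FPT}_{\mathrm{nu}}$.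
   Context: $A\triangle B=(A\setminus B)\cup(B\setminus A)$. A Turing machine $\Phi$ is a partial decision procedure for $A$ if $\Phi(x)=1\Rightarrow x\in A$ and $\Phi(x)=0\Rightarrow x\notin A$; $\mathrm{dom}(\Phi)=\{x:\Phi(x)\in\{0,1\}\}$. An $O(n^c)$-approximation for $A$ is a partial decision procedure for $A$ halting on all inputs in time $O(n^c)$; an $O(n^c)$-slice for $A$ is the domain of one. A parameter space is a nonempty set $\Omega$ with a reflexive, transitive, directed relation and an injective encoding into $\{0,1\}^+$. A parameterization over $\Omega$ is $\eta\subseteq\{0,1\}^+\times\Omega$ such that for every $x$, $\{k:(x,k)\in\eta\}$ is nonempty and upward closed; $\eta_k=\{x:(x,k)\in\eta\}$. $(A,\eta)\in\mathbf{FPT}_{\mathrm{nu}}$ if there is a constant $c$ such that every $\eta_k$ is an $O(n^c)$-slice for $A$. $\mathcal F^{\preccurlyeq_{\mathrm{nu}}}_{(A,\mathbf{FPT}_{\mathrm{nu}})}$ denotes the set of parameterizations $\eta$ with $(A,\eta)\in\mathbf{FPT}_{\mathrm{nu}}$. *)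

theory Defs
  imports Complex_Main "HOL-Library.Landau_Symbols"
begin

definition bin_plus :: "bool list set" where
  "bin_plus = {x. x \<noteq> []}"

section \<open>Deterministic multitape Turing machines\<close>

text \<open>
  Tapes are infinite in both directions; a tape is given by its contents together with its head
  position. Tape symbols are the natural numbers below \<open>nsyms\<close>, with \<open>0\<close> the blank and \<open>1\<close>, \<open>2\<close>
  the input symbols for the bits 0 and 1. The output of a halting computation is the label
  \<open>out q\<close> of the halting state \<open>q\<close> in which it ends; an output other than 0 and 1 gives no
  decision.
\<close>

datatype move = MoveLeft | Stay | MoveRight

type_synonym tape = "(int \<Rightarrow> nat) \<times> int"

record 'q tm =
  ntapes :: nat
  nsyms :: nat
  states :: "'q set"
  start :: 'q
  halting :: "'q set"
  out :: "'q \<Rightarrow> nat"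
  trans_fun :: "'q \<Rightarrow> nat list \<Rightarrow> 'q \<times> (nat \<times> move) list"

definition turing_machine :: "'q tm \<Rightarrow> bool" where
  "turing_machine M \<longleftrightarrow>
     1 \<le> ntapes M \<and> 3 \<le> nsyms M \<and>
     finite (states M) \<and> start M \<in> states M \<and> halting M \<subseteq> states M \<and>
     (\<forall>q \<in> states M - halting M. \<forall>ss. length ss = ntapes M \<and> set ss \<subseteq> {..<nsyms M} \<longrightarrow>
        (case trans_fun M q ss of (q', as) \<Rightarrow>
           q' \<in> states M \<and> length as = ntapes M \<and> fst ` set as \<subseteq> {..<nsyms M}))"

fun displacement :: "move \<Rightarrow> int" where
  "displacement MoveLeft = - 1"
| "displacement Stay = 0"
| "displacement MoveRight = 1"

fun scanned :: "tape \<Rightarrow> nat" where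
  "scanned (f, h) = f h"

fun act :: "nat \<times> move \<Rightarrow> tape \<Rightarrow> tape" where
  "act (s, m) (f, h) = (f(h := s), h + displacement m)"

type_synonym 'q config = "'q \<times> tape list"

fun step :: "'q tm \<Rightarrow> 'q config \<Rightarrow> 'q config" where
  "step M (q, ts) =
     (if q \<in> halting M then (q, ts)
      else (case trans_fun M q (map scanned ts) of (q', as) \<Rightarrow> (q', map2 act as ts)))"

definition blank_tape :: tape where
  "blank_tape = (\<lambda>_. 0, 0)"

definition input_tape :: "bool list \<Rightarrow> tape" where
  "input_tape x =
     (\<lambda>i. if 0 \<le> i \<and> i < int (length x) then (if x ! nat i then 2 else 1) else 0, 0)"

definition initial :: "'q tm \<Rightarrow> bool list \<Rightarrow> 'q config" where
  "initial M x = (start M, input_tape x # replicate (ntapes M - 1) blank_tape)"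

definition state_after :: "'q tm \<Rightarrow> bool list \<Rightarrow> nat \<Rightarrow> 'q" where
  "state_after M x t = fst ((step M ^^ t) (initial M x))"

definition halts_within :: "'q tm \<Rightarrow> bool list \<Rightarrow> nat \<Rightarrow> bool" where
  "halts_within M x t \<longleftrightarrow> state_after M x t \<in> halting M"

definition outputs :: "'q tm \<Rightarrow> bool list \<Rightarrow> nat \<Rightarrow> bool" where
  "outputs M x y \<longleftrightarrow> (\<exists>t. halts_within M x t \<and> out M (state_after M x t) = y)"

section \<open>Approximations and slices\<close>

definition partial_decision_procedure :: "'q tm \<Rightarrow> bool list set \<Rightarrow> bool" where
  "partial_decision_procedure M A \<longleftrightarrow> turing_machine M \<and>
     (\<forall>x \<in> bin_plus. (outputs M x 1 \<longrightarrow> x \<in> A) \<and> (outputs M x 0 \<longrightarrow> x \<notin> A))"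

definition decision_dom :: "'q tm \<Rightarrow> bool list set" where
  "decision_dom M = {x \<in> bin_plus. outputs M x 0 \<or> outputs M x 1}"

definition halts_in_time_O :: "nat \<Rightarrow> 'q tm \<Rightarrow> bool" where
  "halts_in_time_O c M \<longleftrightarrow>
     (\<exists>T :: nat \<Rightarrow> nat. (\<lambda>n. real (T n)) \<in> O(\<lambda>n. real n ^ c) \<and>
        (\<forall>x \<in> bin_plus. halts_within M x (T (length x))))"

definition approximation :: "nat \<Rightarrow> 'q tm \<Rightarrow> bool list set \<Rightarrow> bool" where
  "approximation c M A \<longleftrightarrow> partial_decision_procedure M A \<and> halts_in_time_O c M"

text \<open>
  Since state sets are finite, taking states from \<^typ>\<open>nat\<close> loses no machines up to renaming.
\<close>

definition slice :: "nat \<Rightarrow> bool list set \<Rightarrow> bool list set \<Rightarrow> bool" where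
  "slice c A S \<longleftrightarrow> (\<exists>M :: nat tm. approximation c M A \<and> S = decision_dom M)"

section \<open>Parameterizations\<close>

record 'k param_space =
  params :: "'k set"
  below :: "'k rel"
  encoding :: "'k \<Rightarrow> bool list"

definition parameter_space :: "'k param_space \<Rightarrow> bool" where
  "parameter_space \<Omega> \<longleftrightarrow>
     params \<Omega> \<noteq> {} \<and>
     below \<Omega> \<subseteq> params \<Omega> \<times> params \<Omega> \<and> refl_on (params \<Omega>) (below \<Omega>) \<and> trans (below \<Omega>) \<and>
     (\<forall>k \<in> params \<Omega>. \<forall>l \<in> params \<Omega>. \<exists>m \<in> params \<Omega>. (k, m) \<in> below \<Omega> \<and> (l, m) \<in> below \<Omega>) \<and>
     inj_on (encoding \<Omega>) (params \<Omega>) \<and> encoding \<Omega> ` params \<Omega> \<subseteq> bin_plus"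

text \<open>A parameterization is represented together with the parameter space it is over.\<close>

type_synonym 'k parameterization = "'k param_space \<times> (bool list \<times> 'k) set"

definition parameterizations :: "'k parameterization set" where
  "parameterizations = {(\<Omega>, \<eta>). parameter_space \<Omega> \<and> \<eta> \<subseteq> bin_plus \<times> params \<Omega> \<and>
     (\<forall>x \<in> bin_plus. {k. (x, k) \<in> \<eta>} \<noteq> {} \<and>
        (\<forall>k l. (x, k) \<in> \<eta> \<and> (k, l) \<in> below \<Omega> \<longrightarrow> (x, l) \<in> \<eta>))}"

definition section_at :: "(bool list \<times> 'k) set \<Rightarrow> 'k \<Rightarrow> bool list set" where
  "section_at \<eta> k = {x. (x, k) \<in> \<eta>}"

definition FPT_nu :: "(bool list set \<times> 'k parameterization) set" where
  "FPT_nu = {(A, (\<Omega>, \<eta>)). (\<Omega>, \<eta>) \<in> parameterizations \<and>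
     (\<exists>c. \<forall>k \<in> params \<Omega>. slice c A (section_at \<eta> k))}"

definition FPT_nu_filter :: "bool list set \<Rightarrow> 'k parameterization set" where
  "FPT_nu_filter A = {p \<in> parameterizations. (A, p) \<in> FPT_nu}"

end

theory Submission
  imports Defs "HOL-Library.Nat_Bijection"
begin

text \<open>
  If both problems are in FPT via the same parameterization, then every section is the domain of
  a polynomial-time approximation for \<open>A\<close> as well as of one for \<open>B\<close>. A machine that copies its
  input to a second block of tapes, runs both approximations in parallel and outputs the exclusive
  or of the two answers is an approximation for the symmetric difference with the same domain.
  Copying adds only linear time.
\<close>

section \<open>Runs of Turing machines\<close>

text \<open>Transitions completed by idling on halting states and on symbols outside the alphabet.\<close>

definition total_trans :: "'q tm \<Rightarrow> 'q \<Rightarrow> nat list \<Rightarrow> 'q \<times> (nat \<times> move) list" where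
  "total_trans M q ss =
     (if q \<in> halting M \<or> \<not> set ss \<subseteq> {..<nsyms M} then (q, map (\<lambda>s. (s, Stay)) ss)
      else trans_fun M q ss)"

text \<open>The invariant of runs under which \<open>step\<close> agrees with
  \<open>total_trans\<close>: as all tape contents lie in the alphabet, the heads never scan a
  foreign symbol.\<close>

definition valid_config :: "'q tm \<Rightarrow> 'q config \<Rightarrow> bool" where
  "valid_config M c \<longleftrightarrow> fst c \<in> states M \<and> length (snd c) = ntapes M \<and>
     (\<forall>t \<in> set (snd c). \<forall>i. fst t i < nsyms M)"

text \<open>The bound \<open>K\<close> may exceed \<open>nsyms M\<close> because the parallel
  machine works over the larger of two alphabets; on a symbol foreign to \<open>M\<close> the idle
  action writes back what was read, so the bound survives.\<close>

lemma total_trans_well_formed: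
  assumes "turing_machine M" "q \<in> states M" "length ss = ntapes M" "total_trans M q ss = (q', as)"
  shows "q' \<in> states M" "length as = ntapes M"
    and "\<And>K. nsyms M \<le> K \<Longrightarrow> set ss \<subseteq> {..<K} \<Longrightarrow> fst ` set as \<subseteq> {..<K}"
proof -
  have "q' \<in> states M \<and> length as = ntapes M \<and>
    (\<forall>K. nsyms M \<le> K \<longrightarrow> set ss \<subseteq> {..<K} \<longrightarrow> fst ` set as \<subseteq> {..<K})"
  proof (cases "q \<in> halting M \<or> \<not> set ss \<subseteq> {..<nsyms M}")
    case True
    then have "q' = q" "as = map (\<lambda>s. (s, Stay)) ss"
      using assms(4) by (auto simp: total_trans_def)
    then show ?thesis using assms by (simp add: image_image)
  next
    case False
    then have "trans_fun M q ss = (q', as)" using assms(4) by (simp add: total_trans_def)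
    moreover have q: "q \<in> states M - halting M" and ss: "length ss = ntapes M \<and> set ss \<subseteq> {..<nsyms M}"
      using False assms(2,3) by auto
    have "case trans_fun M q ss of (q', as) \<Rightarrow>
        q' \<in> states M \<and> length as = ntapes M \<and> fst ` set as \<subseteq> {..<nsyms M}"
      using assms(1)[unfolded turing_machine_def] q ss by (elim conjE) (drule (1) bspec, simp)
    ultimately have "q' \<in> states M" "length as = ntapes M" "fst ` set as \<subseteq> {..<nsyms M}"
      by simp_all
    then show ?thesis by (meson lessThan_subset_iff subset_trans)
  qed
  then show "q' \<in> states M" "length as = ntapes M"
    and "\<And>K. nsyms M \<le> K \<Longrightarrow> set ss \<subseteq> {..<K} \<Longrightarrow> fst ` set as \<subseteq> {..<K}"
    by blast+
qed

lemma act_scanned_Stay: "act (scanned t, Stay) t = t"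
  by (cases t) simp

lemma map2_act_idle: "map2 act (map (\<lambda>s. (s, Stay)) (map scanned ts)) ts = ts"
  by (induction ts) (simp_all add: act_scanned_Stay)

lemma valid_config_scanned:
  assumes "valid_config M (q, ts)"
  shows "set (map scanned ts) \<subseteq> {..<nsyms M}"
  using assms by (fastforce simp: valid_config_def)

lemma step_total_trans:
  assumes "valid_config M (q, ts)"
  shows "step M (q, ts) =
    (case total_trans M q (map scanned ts) of (q', as) \<Rightarrow> (q', map2 act as ts))"
proof (cases "q \<in> halting M")
  case True
  then have "total_trans M q (map scanned ts) = (q, map (\<lambda>s. (s, Stay)) (map scanned ts))"
    by (simp add: total_trans_def)
  then show ?thesis using True map2_act_idle[of ts] by (simp del: map_map)
next
  case False
  then show ?thesis using valid_config_scanned[OF assms] by (simp add: total_trans_def)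
qed

lemma valid_config_step:
  assumes M: "turing_machine M" and v: "valid_config M c"
  shows "valid_config M (step M c)"
proof -
  obtain q ts where c: "c = (q, ts)" by fastforce
  obtain q' as where tr: "total_trans M q (map scanned ts) = (q', as)" by fastforce
  have q: "q \<in> states M" "length (map scanned ts) = ntapes M"
    using v c by (auto simp: valid_config_def)
  note wf = total_trans_well_formed[OF M q tr]
  have as: "fst ` set as \<subseteq> {..<nsyms M}"
    by (rule wf(3)[OF order_refl valid_config_scanned[OF v[unfolded c]]])
  have "fst t i < nsyms M" if t: "t \<in> set (map2 act as ts)" for t i
  proof -
    obtain a u where au: "(a, u) \<in> set (zip as ts)" "t = act a u" using t by auto
    then have "fst a < nsyms M" "fst u i < nsyms M"
      using as v c by (auto simp: valid_config_def dest: set_zip_leftD set_zip_rightD)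
    then show ?thesis using au(2) by (cases a; cases u) simp
  qed
  moreover have "step M c = (q', map2 act as ts)"
    using step_total_trans[OF v[unfolded c]] tr c by simp
  ultimately show ?thesis using wf(1,2) q(2) by (auto simp: valid_config_def)
qed

lemma valid_config_initial:
  assumes "turing_machine M"
  shows "valid_config M (initial M x)"
  using assms
  by (auto simp: valid_config_def initial_def turing_machine_def input_tape_def blank_tape_def)

lemma valid_config_run:
  assumes "turing_machine M"
  shows "valid_config M ((step M ^^ t) (initial M x))"
  by (induction t) (simp_all add: assms valid_config_initial valid_config_step)

lemma state_after_halted:
  assumes "halts_within M x t" "t \<le> t'"
  shows "state_after M x t' = state_after M x t"
  using assms(2)
proof (induction rule: dec_induct)
  case (step m)
  obtain q ts where "(step M ^^ m) (initial M x) = (q, ts)" by fastforce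
  with step.IH assms(1) show ?case
    by (simp add: state_after_def halts_within_def)
qed simp

lemma halts_within_mono: "halts_within M x t \<Longrightarrow> t \<le> t' \<Longrightarrow> halts_within M x t'"
  using state_after_halted by (metis halts_within_def)

text \<open>Halting configurations are fixed points of \<open>step\<close>, so any two halting times
  show the same state and the output can be read off at any one of them.\<close>

lemma outputs_iff:
  assumes "halts_within M x t"
  shows "outputs M x y \<longleftrightarrow> out M (state_after M x t) = y"
  using assms state_after_halted unfolding outputs_def by (metis linorder_linear)

section \<open>The parallel machine\<close>

text \<open>Slices ask for machines with states in \<open>nat\<close>, so pairs are coded as
  numbers; the shift by 2 keeps 0 and 1 free for the copying phase.\<close>

definition pair_state :: "nat \<Rightarrow> nat \<Rightarrow> nat" where
  "pair_state q r = prod_encode (q, r) + 2"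

definition unpair_state :: "nat \<Rightarrow> nat \<times> nat" where
  "unpair_state p = prod_decode (p - 2)"

lemma unpair_pair_state [simp]: "unpair_state (pair_state q r) = (q, r)"
  by (simp add: pair_state_def unpair_state_def)

lemma pair_state_neq [simp]:
  "pair_state q r \<noteq> 0" "pair_state q r \<noteq> Suc 0"
  "0 \<noteq> pair_state q r" "Suc 0 \<noteq> pair_state q r"
  by (simp_all add: pair_state_def)

lemma pair_state_inject [simp]: "pair_state q r = pair_state q' r' \<longleftrightarrow> q = q' \<and> r = r'"
  by (simp add: pair_state_def)

text \<open>The same action on the first tape of each block; all other tapes are blank during
  copying, and \<open>(0, Stay)\<close> keeps them so.\<close>

definition first_tapes_action :: "nat tm \<Rightarrow> nat tm \<Rightarrow> nat \<times> move \<Rightarrow> (nat \<times> move) list" where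
  "first_tapes_action M N a =
     (a # replicate (ntapes M - 1) (0, Stay)) @ (a # replicate (ntapes N - 1) (0, Stay))"

text \<open>State 0 copies the input rightwards, state 1 rewinds both heads to the first input symbol.\<close>

definition xor_trans :: "nat tm \<Rightarrow> nat tm \<Rightarrow> nat \<Rightarrow> nat list \<Rightarrow> nat \<times> (nat \<times> move) list" where
  "xor_trans M N p ss =
     (if p = 0 then
        if hd ss = 0 then (1, first_tapes_action M N (0, MoveLeft))
        else (0, first_tapes_action M N (hd ss, MoveRight))
      else if p = 1 then
        if hd ss = 0 then (pair_state (start M) (start N), first_tapes_action M N (0, MoveRight))
        else (1, first_tapes_action M N (hd ss, MoveLeft))
      else case unpair_state p of (q, r) \<Rightarrow>
        case total_trans M q (take (ntapes M) ss) of (q', as) \<Rightarrow>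
          case total_trans N r (drop (ntapes M) ss) of (r', bs) \<Rightarrow> (pair_state q' r', as @ bs))"

text \<open>The value 2 stands for no decision and results as soon as one of the two answers is not
  a decision.\<close>

definition xor_out :: "nat \<Rightarrow> nat \<Rightarrow> nat" where
  "xor_out a b = (if a \<le> 1 \<and> b \<le> 1 then if a = b then 0 else 1 else 2)"

text \<open>Halting requires both components to have halted; the one that finishes first waits,
  since \<open>total_trans\<close> idles on its halting states.\<close>

definition xor_tm :: "nat tm \<Rightarrow> nat tm \<Rightarrow> nat tm" where
  "xor_tm M N =
     \<lparr>ntapes = ntapes M + ntapes N, nsyms = max (nsyms M) (nsyms N),
      states = {0, 1} \<union> case_prod pair_state ` (states M \<times> states N), start = 0,
      halting = case_prod pair_state ` (halting M \<times> halting N),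
      out = (\<lambda>p. case unpair_state p of (q, r) \<Rightarrow> xor_out (out M q) (out N r)),
      trans_fun = xor_trans M N\<rparr>"

lemma xor_tm_simps [simp]:
  "ntapes (xor_tm M N) = ntapes M + ntapes N"
  "start (xor_tm M N) = 0"
  "out (xor_tm M N) (pair_state q r) = xor_out (out M q) (out N r)"
  "trans_fun (xor_tm M N) = xor_trans M N"
  "0 \<notin> halting (xor_tm M N)"
  "Suc 0 \<notin> halting (xor_tm M N)"
  "pair_state q r \<in> halting (xor_tm M N) \<longleftrightarrow> q \<in> halting M \<and> r \<in> halting N"
  by (simp_all add: xor_tm_def image_iff)

text \<open>Transitions must be well formed on every word over the larger alphabet, including words
  that no run reaches; \<open>total_trans\<close> supplies them there.\<close>

lemma turing_machine_xor_tm: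
  assumes M: "turing_machine M" and N: "turing_machine N"
  shows "turing_machine (xor_tm M N)"
proof -
  let ?K = "max (nsyms M) (nsyms N)" and ?S = "states (xor_tm M N)"
  have basic: "1 \<le> ntapes M" "1 \<le> ntapes N" "3 \<le> nsyms M" "finite (states M)" "finite (states N)"
    "start M \<in> states M" "start N \<in> states N" "halting M \<subseteq> states M" "halting N \<subseteq> states N"
    using M N by (auto simp: turing_machine_def)
  have S: "?S = {0, 1} \<union> case_prod pair_state ` (states M \<times> states N)" by (simp add: xor_tm_def)
  have K: "nsyms (xor_tm M N) = ?K" by (simp add: xor_tm_def)
  have first: "length (first_tapes_action M N (s, m)) = ntapes M + ntapes N \<and>
      fst ` set (first_tapes_action M N (s, m)) \<subseteq> {..<?K}" if "s < ?K" for s m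
    using that basic by (auto simp: first_tapes_action_def)
  have tr: "q' \<in> ?S \<and> length as = ntapes M + ntapes N \<and> fst ` set as \<subseteq> {..<?K}"
    if p: "p \<in> ?S" and len: "length ss = ntapes M + ntapes N" and ss: "set ss \<subseteq> {..<?K}"
      and eq: "xor_trans M N p ss = (q', as)" for p ss q' as
  proof (cases "p = 0 \<or> p = 1")
    case True
    have "ss \<noteq> []" using len basic by auto
    then have "hd ss < ?K" using ss by (metis hd_in_set lessThan_iff subsetD)
    moreover have "0 < ?K" using basic by simp
    moreover have "{0, 1, pair_state (start M) (start N)} \<subseteq> ?S" using basic S by auto
    ultimately show ?thesis using True eq first
      by (auto simp: xor_trans_def split: if_splits)
  next
    case False
    then obtain q r where qr: "p = pair_state q r" "q \<in> states M" "r \<in> states N"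
      using p S by auto
    obtain q1 as1 where t1: "total_trans M q (take (ntapes M) ss) = (q1, as1)" by fastforce
    obtain r1 as2 where t2: "total_trans N r (drop (ntapes M) ss) = (r1, as2)" by fastforce
    have l: "length (take (ntapes M) ss) = ntapes M" "length (drop (ntapes M) ss) = ntapes N"
      using len by auto
    have s: "set (take (ntapes M) ss) \<subseteq> {..<?K}" "set (drop (ntapes M) ss) \<subseteq> {..<?K}"
      using ss set_take_subset set_drop_subset by (metis subset_trans)+
    note w1 = total_trans_well_formed[OF M qr(2) l(1) t1]
    note w2 = total_trans_well_formed[OF N qr(3) l(2) t2]
    have "q' = pair_state q1 r1" "as = as1 @ as2"
      using eq qr(1) t1 t2 by (simp_all add: xor_trans_def)
    then show ?thesis
      using w1(1,2) w2(1,2) w1(3)[OF max.cobounded1 s(1)] w2(3)[OF max.cobounded2 s(2)] S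
      by (auto simp: image_Un)
  qed
  have "halting (xor_tm M N) \<subseteq> ?S" "finite ?S" "0 \<in> ?S"
    using basic by (auto simp: xor_tm_def)
  moreover have "case xor_trans M N p ss of (q', as) \<Rightarrow>
      q' \<in> ?S \<and> length as = ntapes M + ntapes N \<and> fst ` set as \<subseteq> {..<?K}"
    if "p \<in> ?S - halting (xor_tm M N)"
      and "length ss = ntapes M + ntapes N \<and> set ss \<subseteq> {..<?K}" for p ss
    using tr[OF _ _ _ surjective_pairing] that by (simp only: case_prod_beta) blast
  ultimately show ?thesis
    using basic unfolding turing_machine_def K xor_tm_simps by (intro conjI ballI allI impI) auto
qed

section \<open>Lockstep simulation of the two machines\<close>

lemma xor_tm_simulation_step:
  assumes "turing_machine M" "turing_machine N"
    and v: "valid_config M (q, ts)" "valid_config N (r, us)"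
    and "step M (q, ts) = (q', ts')" "step N (r, us) = (r', us')"
  shows "step (xor_tm M N) (pair_state q r, ts @ us) = (pair_state q' r', ts' @ us')"
proof -
  have len: "length ts = ntapes M" "length us = ntapes N"
    using v by (simp_all add: valid_config_def)
  obtain as where as: "total_trans M q (map scanned ts) = (q', as)" "ts' = map2 act as ts"
    using step_total_trans[OF v(1)] assms(5) by (auto split: prod.splits)
  obtain bs where bs: "total_trans N r (map scanned us) = (r', bs)" "us' = map2 act bs us"
    using step_total_trans[OF v(2)] assms(6) by (auto split: prod.splits)
  \<comment> \<open>Equal lengths of \<open>as\<close> and \<open>ts\<close> make
    \<open>map2\<close> split along the two blocks.\<close>
  have "length as = ntapes M"
    using total_trans_well_formed(2)[OF assms(1) _ _ as(1)] v(1) by (simp add: valid_config_def)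
  then have zip: "map2 act (as @ bs) (ts @ us) = ts' @ us'"
    using len as(2) bs(2) by simp
  show ?thesis
  \<comment> \<open>If both components have halted, all three machines are frozen. Otherwise the
    parallel machine really moves, even if one component merely idles.\<close>
  proof (cases "q \<in> halting M \<and> r \<in> halting N")
    case True
    then show ?thesis using assms(5,6) by simp
  next
    case False
    then have "pair_state q r \<notin> halting (xor_tm M N)" by simp
    moreover have "xor_trans M N (pair_state q r) (map scanned (ts @ us)) =
        (pair_state q' r', as @ bs)"
      using len as(1) bs(1) by (simp add: xor_trans_def)
    ultimately show ?thesis using zip by auto
  qed
qed

lemma xor_tm_simulation:
  fixes x :: "bool list"
  assumes "turing_machine M" "turing_machine N"
  defines "cM \<equiv> \<lambda>t. (step M ^^ t) (initial M x)" and "cN \<equiv> \<lambda>t. (step N ^^ t) (initial N x)"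
  shows "(step (xor_tm M N) ^^ t)
      (pair_state (start M) (start N), snd (initial M x) @ snd (initial N x)) =
    (pair_state (fst (cM t)) (fst (cN t)), snd (cM t) @ snd (cN t))"
proof (induction t)
  case 0
  show ?case by (simp add: cM_def cN_def initial_def)
next
  case (Suc t)
  have "step (xor_tm M N) (pair_state (fst (cM t)) (fst (cN t)), snd (cM t) @ snd (cN t)) =
    (pair_state (fst (cM (Suc t))) (fst (cN (Suc t))), snd (cM (Suc t)) @ snd (cN (Suc t)))"
    using valid_config_run assms by (intro xor_tm_simulation_step) simp_all
  then show ?case using Suc by simp
qed

section \<open>Copying the input to the second block of tapes\<close>

definition loaded_tapes ::
    "nat tm \<Rightarrow> nat tm \<Rightarrow> (int \<Rightarrow> nat) \<Rightarrow> (int \<Rightarrow> nat) \<Rightarrow> int \<Rightarrow> tape list" where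
  "loaded_tapes M N f g h =
     ((f, h) # replicate (ntapes M - 1) blank_tape) @ ((g, h) # replicate (ntapes N - 1) blank_tape)"

lemma map2_first_tapes_action:
  "map2 act (first_tapes_action M N (s, m)) (loaded_tapes M N f g h) =
     loaded_tapes M N (f(h := s)) (g(h := s)) (h + displacement m)"
proof -
  have "act (0, Stay) blank_tape = blank_tape" by (auto simp: blank_tape_def)
  then show ?thesis by (simp add: first_tapes_action_def loaded_tapes_def)
qed

text \<open>Only the symbol on the first tape of the first block decides the branch. Writing it back
  leaves \<open>f\<close> unchanged, while the same action transfers it to \<open>g\<close>.\<close>

lemma step_xor_tm_loaded:
  "step (xor_tm M N) (0, loaded_tapes M N f g h) =
     (if f h = 0 then (1, loaded_tapes M N (f(h := 0)) (g(h := 0)) (h - 1))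
      else (0, loaded_tapes M N f (g(h := f h)) (h + 1)))"
  "step (xor_tm M N) (1, loaded_tapes M N f g h) =
     (if f h = 0 then (pair_state (start M) (start N),
        loaded_tapes M N (f(h := 0)) (g(h := 0)) (h + 1))
      else (1, loaded_tapes M N f (g(h := f h)) (h - 1)))"
proof -
  have "hd (map scanned (loaded_tapes M N f g h)) = f h" by (simp add: loaded_tapes_def)
  then show "step (xor_tm M N) (0, loaded_tapes M N f g h) =
     (if f h = 0 then (1, loaded_tapes M N (f(h := 0)) (g(h := 0)) (h - 1))
      else (0, loaded_tapes M N f (g(h := f h)) (h + 1)))"
  "step (xor_tm M N) (1, loaded_tapes M N f g h) =
     (if f h = 0 then (pair_state (start M) (start N),
        loaded_tapes M N (f(h := 0)) (g(h := 0)) (h + 1))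
      else (1, loaded_tapes M N f (g(h := f h)) (h - 1)))"
    by (simp_all add: xor_trans_def map2_first_tapes_action)
qed

text \<open>With n the input length, the time is n steps of copying, one step turning around at the
  blank behind the input, n steps of rewinding, and one step from the blank at position -1 back to
  position 0.\<close>

lemma xor_tm_copy:
  assumes M: "turing_machine M" and N: "turing_machine N"
  shows "(step (xor_tm M N) ^^ (2 * length x + 2)) (initial (xor_tm M N) x) =
    (pair_state (start M) (start N), snd (initial M x) @ snd (initial N x))"
proof -
  let ?n = "length x" and ?P = "xor_tm M N"
  define f where "f = fst (input_tape x)"
  \<comment> \<open>The copy tape after \<open>t\<close> steps: the part of the input to the left of
    position \<open>t\<close>.\<close>
  define pre where "pre = (\<lambda>t i. if i < int t then f i else 0)"
  \<comment> \<open>Input bits are written as 1 and 2, so the blank 0 reliably marks both ends of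
    the input.\<close>
  have f0: "f i = 0 \<longleftrightarrow> \<not> (0 \<le> i \<and> i < int ?n)" for i
    by (simp add: f_def input_tape_def)
  have pre0: "pre 0 = (\<lambda>_. 0)" and pren: "pre ?n = f"
    using f0 by (auto simp: pre_def fun_eq_iff)
  have tapes: "1 \<le> ntapes M" "1 \<le> ntapes N" using M N by (auto simp: turing_machine_def)
  have init: "initial ?P x = (0, loaded_tapes M N f (pre 0) 0)"
  proof -
    \<comment> \<open>One of the initially blank tapes is singled out as the first tape of the
      second block.\<close>
    have "ntapes M + ntapes N - 1 = (ntapes M - 1) + Suc (ntapes N - 1)" using tapes by simp
    then have "replicate (ntapes M + ntapes N - 1) blank_tape = replicate (ntapes M - 1) blank_tape @
        blank_tape # replicate (ntapes N - 1) blank_tape"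
      by (simp only: replicate_add replicate_Suc)
    moreover have "input_tape x = (f, 0)" by (simp add: f_def input_tape_def)
    ultimately show ?thesis
      by (simp add: initial_def loaded_tapes_def pre0 blank_tape_def)
  qed
  have copy: "(step ?P ^^ t) (initial ?P x) = (0, loaded_tapes M N f (pre t) (int t))"
    if "t \<le> ?n" for t
    using that
  proof (induction t)
    case 0
    show ?case using init by simp
  next
    case (Suc t)
    have "(pre t)(int t := f (int t)) = pre (Suc t)" by (auto simp: pre_def fun_eq_iff)
    then show ?case using Suc f0[of "int t"]
      by (simp add: step_xor_tm_loaded add.commute del: step.simps)
  qed
  \<comment> \<open>Rewinding also writes the first tape onto the second, which is harmless because
    the two already agree.\<close>
  have rewind: "(step ?P ^^ h) (1, loaded_tapes M N f f (int h - 1)) = (1, loaded_tapes M N f f (- 1))"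
    if "h \<le> ?n" for h
    using that
  proof (induction h)
    case (Suc h)
    have "step ?P (1, loaded_tapes M N f f (int (Suc h) - 1)) =
        (1, loaded_tapes M N f f (int h - 1))"
      using Suc.prems f0[of "int h"] step_xor_tm_loaded(2)[of M N f f "int h"] by simp
    then show ?case using Suc by (simp add: funpow_Suc_right del: funpow.simps)
  qed simp
  have turn: "step ?P (0, loaded_tapes M N f f (int ?n)) = (1, loaded_tapes M N f f (int ?n - 1))"
  proof -
    have "f(int ?n := 0) = f" using f0[of "int ?n"] by auto
    then show ?thesis using f0[of "int ?n"] step_xor_tm_loaded(1)[of M N f f "int ?n"] by simp
  qed
  have enter: "step ?P (1, loaded_tapes M N f f (- 1)) =
      (pair_state (start M) (start N), loaded_tapes M N f f 0)"
  proof -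
    have "f(- 1 := 0) = f" using f0[of "- 1"] by auto
    then show ?thesis using f0[of "- 1"] step_xor_tm_loaded(2)[of M N f f "- 1"] by simp
  qed
  have "(step ?P ^^ (2 * ?n + 2)) (initial ?P x) =
      step ?P ((step ?P ^^ ?n) (step ?P ((step ?P ^^ ?n) (initial ?P x))))"
  proof -
    have "2 * ?n + 2 = Suc (?n + Suc ?n)" by simp
    then show ?thesis by (simp only: funpow_add funpow.simps o_apply)
  qed
  also have "\<dots> = (pair_state (start M) (start N), loaded_tapes M N f f 0)"
    by (simp only: copy[OF order_refl] pren turn rewind[OF order_refl] enter)
  also have "loaded_tapes M N f f 0 = snd (initial M x) @ snd (initial N x)"
    by (simp add: loaded_tapes_def initial_def f_def input_tape_def)
  finally show ?thesis .
qed

text \<open>Once the copying steps are over, both components start from their own initial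
  configurations on \<open>x\<close> and run in lockstep.\<close>

lemma state_after_xor_tm:
  assumes "turing_machine M" "turing_machine N"
  shows "state_after (xor_tm M N) x (t + (2 * length x + 2)) =
    pair_state (state_after M x t) (state_after N x t)"
  unfolding state_after_def funpow_add[of t "2 * length x + 2"] o_apply xor_tm_copy[OF assms] xor_tm_simulation[OF assms]
  by simp

section \<open>Slices for the symmetric difference\<close>

text \<open>The parallel machine decides exactly where both machines do, and both have domain
  \<open>S\<close>. The 1 in the exponent pays for the linear copying time.\<close>

lemma slice_sym_diff:
  assumes "slice c A S" "slice d B S"
  shows "slice (max 1 (max c d)) (sym_diff A B) S"
proof -
  let ?e = "max 1 (max c d)"
  obtain M :: "nat tm" where M: "approximation c M A" "S = decision_dom M"
    using assms(1) by (auto simp: slice_def)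
  obtain N :: "nat tm" where N: "approximation d N B" "S = decision_dom N"
    using assms(2) by (auto simp: slice_def)
  let ?P = "xor_tm M N"
  have tm: "turing_machine M" "turing_machine N"
    using M N by (auto simp: approximation_def partial_decision_procedure_def)
  obtain T where T: "(\<lambda>n. real (T n)) \<in> O(\<lambda>n. real n ^ c)"
    "\<And>x. x \<in> bin_plus \<Longrightarrow> halts_within M x (T (length x))"
    using M by (auto simp: approximation_def halts_in_time_O_def)
  obtain U where U: "(\<lambda>n. real (U n)) \<in> O(\<lambda>n. real n ^ d)"
    "\<And>x. x \<in> bin_plus \<Longrightarrow> halts_within N x (U (length x))"
    using N by (auto simp: approximation_def halts_in_time_O_def)
  \<comment> \<open>The sum \<open>T n + U n\<close> bounds both running times and stays within the
    larger order; \<open>2 * n + 2\<close> is the copying time.\<close>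
  define V where "V = (\<lambda>n. T n + U n + (2 * n + 2))"
  have halt: "halts_within ?P x (V (length x))"
    and out_iff: "outputs ?P x y \<longleftrightarrow> (\<exists>a b. outputs M x a \<and> outputs N x b \<and> y = xor_out a b)"
    if x: "x \<in> bin_plus" for x y
  proof -
    let ?t = "T (length x) + U (length x)"
    have h: "halts_within M x ?t" "halts_within N x ?t"
      using T(2)[OF x] U(2)[OF x] by (auto intro: halts_within_mono)
    have s: "state_after ?P x (V (length x)) = pair_state (state_after M x ?t) (state_after N x ?t)"
      unfolding V_def by (rule state_after_xor_tm[OF tm])
    show hP: "halts_within ?P x (V (length x))"
      using h s by (simp add: halts_within_def)
    show "outputs ?P x y \<longleftrightarrow> (\<exists>a b. outputs M x a \<and> outputs N x b \<and> y = xor_out a b)"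
      unfolding outputs_iff[OF hP] outputs_iff[OF h(1)] outputs_iff[OF h(2)] s by auto
  qed
  \<comment> \<open>Powers are compared from n = 1 on, since at n = 0 the power with exponent 0 is 1
    while the one with exponent \<open>?e\<close> is 0.\<close>
  have pow: "(\<lambda>n. real n ^ k) \<in> O(\<lambda>n. real n ^ ?e)" if "k \<le> ?e" for k
    using that
    by (intro bigoI[of _ 1] eventually_mono[OF eventually_ge_at_top[of 1]])
      (auto intro: power_increasing)
  have "(\<lambda>n. real (V n)) \<in> O(\<lambda>n. real n ^ ?e)"
  proof -
    have TU: "(\<lambda>n. real (T n)) \<in> O(\<lambda>n. real n ^ ?e)" "(\<lambda>n. real (U n)) \<in> O(\<lambda>n. real n ^ ?e)"
      using landau_o.big_trans[OF T(1) pow] landau_o.big_trans[OF U(1) pow] by simp_all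
    \<comment> \<open>The copying time is written with powers 1 and 0 so that \<open>pow\<close>
      covers both summands.\<close>
    have "(\<lambda>n. 2 * real n ^ 1 + 2 * real n ^ 0) \<in> O(\<lambda>n. real n ^ ?e)"
      using pow[of 1] pow[of 0] by (intro sum_in_bigo) simp_all
    from sum_in_bigo(1)[OF sum_in_bigo(1)[OF TU] this] show ?thesis
      by (simp add: V_def add_ac)
  qed
  then have "halts_in_time_O ?e ?P"
    using halt by (auto simp: halts_in_time_O_def)
  moreover have "partial_decision_procedure ?P (sym_diff A B)"
  proof -
    have "(outputs M x 1 \<longrightarrow> x \<in> A) \<and> (outputs M x 0 \<longrightarrow> x \<notin> A) \<and>
        (outputs N x 1 \<longrightarrow> x \<in> B) \<and> (outputs N x 0 \<longrightarrow> x \<notin> B)" if "x \<in> bin_plus" for x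
      using M(1) N(1) that by (auto simp: approximation_def partial_decision_procedure_def)
    moreover have "1 = xor_out a b \<longleftrightarrow> a = 0 \<and> b = 1 \<or> a = 1 \<and> b = 0"
      "0 = xor_out a b \<longleftrightarrow> a = 0 \<and> b = 0 \<or> a = 1 \<and> b = 1" for a b
      by (auto simp: xor_out_def)
    ultimately show ?thesis
      unfolding partial_decision_procedure_def using turing_machine_xor_tm[OF tm] out_iff by auto
  qed
  moreover have "S = decision_dom ?P"
  proof -
    \<comment> \<open>The combined answer is a decision iff both answers are, so the domain is the
      intersection of the two domains.\<close>
    have xor: "xor_out a b = 0 \<or> xor_out a b = 1 \<longleftrightarrow> (a = 0 \<or> a = 1) \<and> (b = 0 \<or> b = 1)" for a b
      by (auto simp: xor_out_def)
    have "x \<in> decision_dom ?P \<longleftrightarrow> x \<in> decision_dom M \<and> x \<in> decision_dom N" for x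
    proof (cases "x \<in> bin_plus")
      case True
      have "x \<in> decision_dom ?P \<longleftrightarrow>
          (\<exists>a b. outputs M x a \<and> outputs N x b \<and> (xor_out a b = 0 \<or> xor_out a b = 1))"
        unfolding decision_dom_def mem_Collect_eq out_iff[OF True] eq_commute[of _ "xor_out _ _"]
        using True by blast
      then show ?thesis unfolding decision_dom_def mem_Collect_eq xor using True by blast
    qed (simp add: decision_dom_def)
    then show ?thesis using M(2) N(2) by blast
  qed
  ultimately show ?thesis by (auto simp: slice_def approximation_def)
qed

theorem theorem8:
  fixes A B :: "bool list set"
  assumes "A \<subseteq> bin_plus" and "B \<subseteq> bin_plus"
    and "(FPT_nu_filter A :: 'k parameterization set) = FPT_nu_filter B"
  shows "(FPT_nu_filter A :: 'k parameterization set) \<subseteq> FPT_nu_filter (sym_diff A B)"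
proof
  fix p :: "'k parameterization"
  assume pA: "p \<in> FPT_nu_filter A"
  then have pB: "p \<in> FPT_nu_filter B" using assms(3) by simp
  obtain \<Omega> \<eta> where p: "p = (\<Omega>, \<eta>)" by fastforce
  obtain c where "\<forall>k \<in> params \<Omega>. slice c A (section_at \<eta> k)"
    using pA p by (auto simp: FPT_nu_filter_def FPT_nu_def)
  moreover obtain d where "\<forall>k \<in> params \<Omega>. slice d B (section_at \<eta> k)"
    using pB p by (auto simp: FPT_nu_filter_def FPT_nu_def)
  \<comment> \<open>The exponent depends on \<open>c\<close> and \<open>d\<close> alone, so it is
    uniform in \<open>k\<close>, as \<open>FPT_nu\<close> demands.\<close>
  ultimately have "\<forall>k \<in> params \<Omega>. slice (max 1 (max c d)) (sym_diff A B) (section_at \<eta> k)"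
    using slice_sym_diff by blast
  then show "p \<in> FPT_nu_filter (sym_diff A B)"
    using pA p by (auto simp: FPT_nu_filter_def FPT_nu_def)
qed

end
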